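(* Let $P$ and $Q$ be probability measures on measurable spaces $(\Omega_1,\mathcal A_1)$ and $(\Omega_2,\mathcal A_2)$, and let $h:(\Omega_1\times\Omega_2,\mathcal A_1\otimes\mathcal A_2)\to(\mathbb R,\mathcal B)$ be measurable with $\int h^4\,dP\otimes Q<\infty$ and $\int h\,dP\otimes Q=0$. Let $(n_1)_n,(n_2)_n\subset\mathbb N$ satisfy $n_1+n_2=n$ for all $n$ and $\lim_{n\to\infty}\frac{n_2}n=d\in(0,1)$. Let $X_1,\dots,X_{n_1}$ be i.i.d. with law $P$ and $Y_1,\dots,Y_{n_2}$ i.i.d. with law $Q$, all independent (the coordinate variables under $P^{n_1}\otimes Q^{n_2}$). Then $$S_n=\frac1{n_1n_2(n_2-1)}\sum_{i=1}^{n_1}\sum_{j=1}^{n_2}\sum_{\substack{k=1\\k\ne j}}^{n_2}h(X_i,Y_k)\,h(X_i,Y_j)$$ is an unbiased and consistent estimator of $$\int\Bigl(\int h(x,y)\,dQ(y)\Bigr)^2dP(x).$$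
   Context: Unbiased: $E_{P^{n_1}\otimes Q^{n_2}}(S_n)$ equals the stated value (for $n$ with $n_1\ge1$, $n_2\ge2$). Consistent: $S_n$ converges to the stated value in probability under $P^{n_1}\otimes Q^{n_2}$ as $n\to\infty$. *)

theory Defs
  imports "HOL-Probability.Probability"
begin

(* The law of the independent coordinate samples X_1..X_m1 ~ P and Y_1..Y_m2 ~ Q,
   written P^m1 (x) Q^m2 in the informal text; X_i (w) = fst w i and Y_j (w) = snd w j. *)
definition sample_measure ::
    "'a measure \<Rightarrow> 'b measure \<Rightarrow> nat \<Rightarrow> nat \<Rightarrow> ((nat \<Rightarrow> 'a) \<times> (nat \<Rightarrow> 'b)) measure" where
  "sample_measure P Q m1 m2 =
     (\<Pi>\<^sub>M i\<in>{1..m1}. P) \<Otimes>\<^sub>M (\<Pi>\<^sub>M j\<in>{1..m2}. Q)"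

(* The last factor is a real subtraction; the value is 0 in the degenerate cases
   m1 = 0 or m2 < 2, where the informal expression is undefined. *)
definition S_stat ::
    "('a \<times> 'b \<Rightarrow> real) \<Rightarrow> nat \<Rightarrow> nat \<Rightarrow> (nat \<Rightarrow> 'a) \<times> (nat \<Rightarrow> 'b) \<Rightarrow> real" where
  "S_stat h m1 m2 = (\<lambda>(x, y).
     1 / (real m1 * real m2 * (real m2 - 1)) *
       (\<Sum>i\<in>{1..m1}. \<Sum>j\<in>{1..m2}. \<Sum>k\<in>{1..m2} - {j}. h (x i, y k) * h (x i, y j)))"

(* Integrability is required explicitly because the Bochner integral of a
   non-integrable function is 0 by convention. *)
definition unbiased_estimator :: "'c measure \<Rightarrow> ('c \<Rightarrow> real) \<Rightarrow> real \<Rightarrow> bool" where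
  "unbiased_estimator M T \<theta> \<longleftrightarrow> integrable M T \<and> (\<integral>w. T w \<partial>M) = \<theta>"

(* Convergence in probability to a constant, where the n-th variable lives on its own
   probability space M n. Measurability is required explicitly because
   the measure of a non-measurable set is 0 by convention. *)
definition consistent_estimator :: "(nat \<Rightarrow> 'c measure) \<Rightarrow> (nat \<Rightarrow> 'c \<Rightarrow> real) \<Rightarrow> real \<Rightarrow> bool" where
  "consistent_estimator M T \<theta> \<longleftrightarrow>
     (\<forall>n. T n \<in> borel_measurable (M n)) \<and>
     (\<forall>\<epsilon>>0. (\<lambda>n. measure (M n) {w \<in> space (M n). \<bar>T n w - \<theta>\<bar> > \<epsilon>}) \<longlonglongrightarrow> 0)"

end

(* The summands h(X_i, Y_j) h(X_i, Y_k) with j and k distinct all have the stated value as their mean,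
   and their second moments are bounded by the fourth moment C of h. Two summands whose index
   sets share neither the X-index nor any Y-index are independent, hence uncorrelated. Since
   only a fraction 1/n1 + 4/n2 of the pairs of summands can share an index, the variance of S_n is at
   most C (1/n1 + 4/n2), and Chebyshev's inequality yields consistency. *)
theory Submission
  imports Defs
begin

section \<open>Independence on product spaces\<close>

text \<open>Independence turns the joint law into the product of the marginal laws, and Tonelli then
  splits the integral. The \<open>ennreal\<close> form suits indicators of measurable sets, with no
  integrability to check.\<close>

lemma (in prob_space) indep_var_nn_integral_mult:
  fixes f g :: "_ \<Rightarrow> ennreal"
  assumes ind: "indep_var S X T Y"
    and f[measurable]: "f \<in> borel_measurable S" and g[measurable]: "g \<in> borel_measurable T"
  shows "(\<integral>\<^sup>+\<omega>. f (X \<omega>) * g (Y \<omega>) \<partial>M) = (\<integral>\<^sup>+\<omega>. f (X \<omega>) \<partial>M) * (\<integral>\<^sup>+\<omega>. g (Y \<omega>) \<partial>M)"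
proof -
  have [measurable]: "random_variable S X" "random_variable T Y"
    and joint: "distr M S X \<Otimes>\<^sub>M distr M T Y = distr M (S \<Otimes>\<^sub>M T) (\<lambda>\<omega>. (X \<omega>, Y \<omega>))"
    using ind by (auto simp: indep_var_distribution_eq)
  interpret T: prob_space "distr M T Y" by (rule prob_space_distr) simp
  have "(\<integral>\<^sup>+\<omega>. f (X \<omega>) * g (Y \<omega>) \<partial>M) = (\<integral>\<^sup>+z. f (fst z) * g (snd z) \<partial>distr M (S \<Otimes>\<^sub>M T) (\<lambda>\<omega>. (X \<omega>, Y \<omega>)))"
    by (subst nn_integral_distr) simp_all
  also have "\<dots> = (\<integral>\<^sup>+x. \<integral>\<^sup>+y. f x * g y \<partial>distr M T Y \<partial>distr M S X)"
    unfolding joint[symmetric] by (subst T.nn_integral_fst[symmetric]) simp_all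
  also have "\<dots> = (\<integral>\<^sup>+x. f x \<partial>distr M S X) * (\<integral>\<^sup>+y. g y \<partial>distr M T Y)"
    by (simp add: nn_integral_cmult nn_integral_multc)
  also have "\<dots> = (\<integral>\<^sup>+\<omega>. f (X \<omega>) \<partial>M) * (\<integral>\<^sup>+\<omega>. g (Y \<omega>) \<partial>M)"
    by (simp add: nn_integral_distr)
  finally show ?thesis .
qed

text \<open>With the second coordinate frozen, independence of \<open>X\<close> and
  \<open>X'\<close> factorises the inner integral; what remains is a function of \<open>Y\<close>
  times a function of \<open>Y'\<close>, which independence on the second space separates.\<close>

lemma (in pair_prob_space) indep_var_pair_measure:
  assumes X: "M1.indep_var A X A' X'" and Y: "M2.indep_var B Y B' Y'"
  shows "indep_var (A \<Otimes>\<^sub>M B) (\<lambda>(x, y). (X x, Y y)) (A' \<Otimes>\<^sub>M B') (\<lambda>(x, y). (X' x, Y' y))"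
proof -
  have [measurable]: "X \<in> M1 \<rightarrow>\<^sub>M A" "X' \<in> M1 \<rightarrow>\<^sub>M A'" "Y \<in> M2 \<rightarrow>\<^sub>M B" "Y' \<in> M2 \<rightarrow>\<^sub>M B'"
    using X Y by (auto dest: M1.indep_var_rv1 M1.indep_var_rv2 M2.indep_var_rv1 M2.indep_var_rv2)
  let ?U = "\<lambda>(x, y). (X x, Y y)" and ?V = "\<lambda>(x, y). (X' x, Y' y)"
  have *: "emeasure (distr (M1 \<Otimes>\<^sub>M M2) (A \<Otimes>\<^sub>M B) ?U) E * emeasure (distr (M1 \<Otimes>\<^sub>M M2) (A' \<Otimes>\<^sub>M B') ?V) F =
      emeasure (distr (M1 \<Otimes>\<^sub>M M2) ((A \<Otimes>\<^sub>M B) \<Otimes>\<^sub>M (A' \<Otimes>\<^sub>M B')) (\<lambda>w. (?U w, ?V w))) (E \<times> F)"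
    if [measurable]: "E \<in> sets (A \<Otimes>\<^sub>M B)" "F \<in> sets (A' \<Otimes>\<^sub>M B')" for E F
  proof -
    \<comment> \<open>\<open>a v\<close> is the mass that the law of \<open>X\<close> gives to the
      section of \<open>E\<close> at height \<open>v\<close>, so integrating \<open>a (Y y)\<close>
      over \<open>M2\<close> recovers the probability that \<open>(X, Y)\<close> lies in
      \<open>E\<close>; likewise \<open>b\<close> for \<open>F\<close>.\<close>
    define a where "a v = (\<integral>\<^sup>+x. indicator E (X x, v) \<partial>M1)" for v
    define b where "b v = (\<integral>\<^sup>+x. indicator F (X' x, v) \<partial>M1)" for v
    have [measurable]: "a \<in> borel_measurable B" "b \<in> borel_measurable B'"
      unfolding a_def b_def by measurable
    have "emeasure (distr (M1 \<Otimes>\<^sub>M M2) ((A \<Otimes>\<^sub>M B) \<Otimes>\<^sub>M (A' \<Otimes>\<^sub>M B')) (\<lambda>w. (?U w, ?V w))) (E \<times> F)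
      = (\<integral>\<^sup>+w. indicator (E \<times> F) (?U w, ?V w) \<partial>(M1 \<Otimes>\<^sub>M M2))"
      by (subst nn_integral_indicator[symmetric], simp, subst nn_integral_distr) simp_all
    also have "\<dots> = (\<integral>\<^sup>+y. \<integral>\<^sup>+x. indicator E (X x, Y y) * indicator F (X' x, Y' y) \<partial>M1 \<partial>M2)"
      by (subst nn_integral_snd[symmetric]) (simp_all add: indicator_times)
    also have "\<dots> = (\<integral>\<^sup>+y. a (Y y) * b (Y' y) \<partial>M2)"
      unfolding a_def b_def
    proof (rule nn_integral_cong)
      fix y assume y[measurable]: "y \<in> space M2"
      have [measurable]: "Y y \<in> space B" "Y' y \<in> space B'"
        by (auto intro!: measurable_space[OF _ y])
      show "(\<integral>\<^sup>+x. indicator E (X x, Y y) * indicator F (X' x, Y' y) \<partial>M1) =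
        (\<integral>\<^sup>+x. indicator E (X x, Y y) \<partial>M1) * (\<integral>\<^sup>+x. indicator F (X' x, Y' y) \<partial>M1)"
        by (rule M1.indep_var_nn_integral_mult[OF X,
              where f="\<lambda>u. indicator E (u, Y y)" and g="\<lambda>u. indicator F (u, Y' y)"]) measurable
    qed
    also have "\<dots> = (\<integral>\<^sup>+y. a (Y y) \<partial>M2) * (\<integral>\<^sup>+y. b (Y' y) \<partial>M2)"
      by (rule M2.indep_var_nn_integral_mult[OF Y]) measurable
    also have "(\<integral>\<^sup>+y. a (Y y) \<partial>M2) = (\<integral>\<^sup>+w. indicator E (?U w) \<partial>(M1 \<Otimes>\<^sub>M M2))"
      unfolding a_def by (subst nn_integral_snd[symmetric]) simp_all
    also have "\<dots> = emeasure (distr (M1 \<Otimes>\<^sub>M M2) (A \<Otimes>\<^sub>M B) ?U) E"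
      by (subst nn_integral_indicator[symmetric], simp, subst nn_integral_distr) simp_all
    also have "(\<integral>\<^sup>+y. b (Y' y) \<partial>M2) = (\<integral>\<^sup>+w. indicator F (?V w) \<partial>(M1 \<Otimes>\<^sub>M M2))"
      unfolding b_def by (subst nn_integral_snd[symmetric]) simp_all
    also have "\<dots> = emeasure (distr (M1 \<Otimes>\<^sub>M M2) (A' \<Otimes>\<^sub>M B') ?V) F"
      by (subst nn_integral_indicator[symmetric], simp, subst nn_integral_distr) simp_all
    finally show ?thesis ..
  qed
  have "distr (M1 \<Otimes>\<^sub>M M2) (A \<Otimes>\<^sub>M B) ?U \<Otimes>\<^sub>M distr (M1 \<Otimes>\<^sub>M M2) (A' \<Otimes>\<^sub>M B') ?V =
      distr (M1 \<Otimes>\<^sub>M M2) ((A \<Otimes>\<^sub>M B) \<Otimes>\<^sub>M (A' \<Otimes>\<^sub>M B')) (\<lambda>w. (?U w, ?V w))"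
  \<comment> \<open>Agreement on the rectangles \<open>E \<times> F\<close> determines the product
    measure; \<open>E\<close> and \<open>F\<close> themselves range over all measurable sets of
    pairs.\<close>
  proof (rule pair_measure_eqI)
    show "sigma_finite_measure (distr (M1 \<Otimes>\<^sub>M M2) (A \<Otimes>\<^sub>M B) ?U)"
      "sigma_finite_measure (distr (M1 \<Otimes>\<^sub>M M2) (A' \<Otimes>\<^sub>M B') ?V)"
      by (intro prob_space_imp_sigma_finite prob_space_distr; measurable)+
  qed (use * in \<open>auto cong: sets_pair_measure_cong\<close>)
  then show ?thesis
    by (simp add: indep_var_distribution_eq)
qed

text \<open>Independence amounts to the joint law being the product of the marginals, and the joint
  law of all coordinates is the product measure itself.\<close>

lemma indep_vars_PiM_coordinates:
  assumes "prob_space M"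
  shows "prob_space.indep_vars (\<Pi>\<^sub>M i\<in>I. M) (\<lambda>_. M) (\<lambda>i x. x i) I"
proof -
  interpret prob_space "\<Pi>\<^sub>M i\<in>I. M" by (rule prob_space_PiM) (rule assms)
  show ?thesis
  proof (cases "I = {}")
    \<comment> \<open>The characterisation by joint laws requires a nonempty index set.\<close>
    case True
    then show ?thesis unfolding indep_vars_def indep_sets_def by simp
  next
    case False
    \<comment> \<open>Points of the product space are extensional on \<open>I\<close>, so
      restricting them to \<open>I\<close> is the identity.\<close>
    have "distr (\<Pi>\<^sub>M i\<in>I. M) (\<Pi>\<^sub>M i\<in>I. M) (\<lambda>x. \<lambda>i\<in>I. x i) = (\<Pi>\<^sub>M i\<in>I. M)"
      by (rule distr_id2[THEN trans[rotated]], rule refl, rule distr_cong)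
         (auto simp: space_PiM)
    also have "\<dots> = (\<Pi>\<^sub>M i\<in>I. distr (\<Pi>\<^sub>M i\<in>I. M) M (\<lambda>x. x i))"
      by (intro PiM_cong refl) (simp add: distr_PiM_component[where M="\<lambda>_. M"] assms)
    finally show ?thesis
      by (subst indep_vars_iff_distr_eq_PiM'[OF False]) auto
  qed
qed

section \<open>Second moment of a sum with few correlated pairs\<close>

text \<open>The square of the centred sum expands into covariances. Each is at most
  \<open>C\<close>, and for every \<open>a\<close> all but at most \<open>K\<close> of them
  vanish.\<close>

lemma (in prob_space) second_moment_sum_le:
  fixes Z :: "'i \<Rightarrow> 'a \<Rightarrow> real"
  assumes fin: "finite A"
    and meas[measurable]: "\<And>a. a \<in> A \<Longrightarrow> random_variable borel (Z a)"
    and sq: "\<And>a. a \<in> A \<Longrightarrow> integrable M (\<lambda>\<omega>. (Z a \<omega>)\<^sup>2)"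
    and mean: "\<And>a. a \<in> A \<Longrightarrow> expectation (Z a) = \<theta>"
    and bound: "\<And>a. a \<in> A \<Longrightarrow> expectation (\<lambda>\<omega>. (Z a \<omega>)\<^sup>2) \<le> C"
    and corr: "\<And>a. a \<in> A \<Longrightarrow> card {b \<in> A. expectation (\<lambda>\<omega>. Z a \<omega> * Z b \<omega>) \<noteq> \<theta>\<^sup>2} \<le> K"
  shows "integrable M (\<lambda>\<omega>. ((\<Sum>a\<in>A. Z a \<omega>) - real (card A) * \<theta>)\<^sup>2)"
    and "expectation (\<lambda>\<omega>. ((\<Sum>a\<in>A. Z a \<omega>) - real (card A) * \<theta>)\<^sup>2) \<le> real (card A) * real K * C"
proof -
  have int[simp]: "integrable M (Z a)" if "a \<in> A" for a
    using square_integrable_imp_integrable[OF meas sq] that by blast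
  have int2[simp]: "integrable M (\<lambda>\<omega>. Z a \<omega> * Z b \<omega>)" if "a \<in> A" "b \<in> A" for a b
  proof (rule Bochner_Integration.integrable_bound)
    show "integrable M (\<lambda>\<omega>. (Z a \<omega>)\<^sup>2 + (Z b \<omega>)\<^sup>2)" using sq that by simp
    show "AE \<omega> in M. norm (Z a \<omega> * Z b \<omega>) \<le> norm ((Z a \<omega>)\<^sup>2 + (Z b \<omega>)\<^sup>2)"
    proof (rule AE_I2)
      fix \<omega>
      have "2 * (\<bar>Z a \<omega>\<bar> * \<bar>Z b \<omega>\<bar>) \<le> (Z a \<omega>)\<^sup>2 + (Z b \<omega>)\<^sup>2"
        using sum_squares_bound[of "\<bar>Z a \<omega>\<bar>" "\<bar>Z b \<omega>\<bar>"] by simp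
      \<comment> \<open>Nonnegativity allows the factor 2 of the preceding inequality to be
        dropped.\<close>
      moreover have "0 \<le> \<bar>Z a \<omega>\<bar> * \<bar>Z b \<omega>\<bar>" by simp
      ultimately show "norm (Z a \<omega> * Z b \<omega>) \<le> norm ((Z a \<omega>)\<^sup>2 + (Z b \<omega>)\<^sup>2)"
        unfolding real_norm_def abs_mult by linarith
    qed
  qed (use that in measurable)
  have le: "expectation (\<lambda>\<omega>. Z a \<omega> * Z b \<omega>) \<le> C" if "a \<in> A" "b \<in> A" for a b
  proof -
    have "expectation (\<lambda>\<omega>. Z a \<omega> * Z b \<omega>) \<le> expectation (\<lambda>\<omega>. ((Z a \<omega>)\<^sup>2 + (Z b \<omega>)\<^sup>2) / 2)"
    proof (rule integral_mono)
      show "Z a \<omega> * Z b \<omega> \<le> ((Z a \<omega>)\<^sup>2 + (Z b \<omega>)\<^sup>2) / 2" for \<omega>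
        using sum_squares_bound[of "Z a \<omega>" "Z b \<omega>"] by simp
    qed (use that sq in auto)
    also have "\<dots> \<le> C" using that sq bound[OF that(1)] bound[OF that(2)] by simp
    finally show ?thesis .
  qed
  have le': "expectation (\<lambda>\<omega>. Z a \<omega> * Z b \<omega>) - \<theta>\<^sup>2 \<le> C" if "a \<in> A" "b \<in> A" for a b
    using le[OF that] zero_le_power2[of \<theta>] by linarith
  define Y where "Y a \<omega> = Z a \<omega> - \<theta>" for a \<omega>
  have YY: "Y a \<omega> * Y b \<omega> = Z a \<omega> * Z b \<omega> - \<theta> * Z a \<omega> - \<theta> * Z b \<omega> + \<theta>\<^sup>2" for a b \<omega>
    by (simp add: Y_def algebra_simps power2_eq_square)
  have Yint: "integrable M (\<lambda>\<omega>. Y a \<omega> * Y b \<omega>)" if "a \<in> A" "b \<in> A" for a b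
    unfolding YY using that by simp
  have EY: "expectation (\<lambda>\<omega>. Y a \<omega> * Y b \<omega>) = expectation (\<lambda>\<omega>. Z a \<omega> * Z b \<omega>) - \<theta>\<^sup>2"
    if "a \<in> A" "b \<in> A" for a b
    unfolding YY using that by (simp add: mean prob_space power2_eq_square)
  have eq: "((\<Sum>a\<in>A. Z a \<omega>) - real (card A) * \<theta>)\<^sup>2 = (\<Sum>a\<in>A. \<Sum>b\<in>A. Y a \<omega> * Y b \<omega>)" for \<omega>
    unfolding sum_product[symmetric] power2_eq_square by (simp add: Y_def sum_subtractf)
  show "integrable M (\<lambda>\<omega>. ((\<Sum>a\<in>A. Z a \<omega>) - real (card A) * \<theta>)\<^sup>2)"
    unfolding eq using Yint by auto
  \<comment> \<open>The sign of \<open>C\<close> is needed to replace the number of correlated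
    partners by \<open>K\<close>. It follows from a second moment below \<open>C\<close>, hence only
    when \<open>A\<close> has an element.\<close>
  have C: "0 \<le> C" if "a \<in> A" for a
    using bound[OF that] order_trans[OF integral_nonneg_AE] by (smt (verit) AE_I2 zero_le_power2)
  have "expectation (\<lambda>\<omega>. ((\<Sum>a\<in>A. Z a \<omega>) - real (card A) * \<theta>)\<^sup>2) =
      (\<Sum>a\<in>A. \<Sum>b\<in>A. expectation (\<lambda>\<omega>. Z a \<omega> * Z b \<omega>) - \<theta>\<^sup>2)"
    unfolding eq using Yint by (simp add: EY)
  also have "\<dots> \<le> (\<Sum>a\<in>A. real K * C)"
  proof (rule sum_mono)
    fix a assume a: "a \<in> A"
    let ?B = "{b \<in> A. expectation (\<lambda>\<omega>. Z a \<omega> * Z b \<omega>) \<noteq> \<theta>\<^sup>2}"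
    have "(\<Sum>b\<in>A. expectation (\<lambda>\<omega>. Z a \<omega> * Z b \<omega>) - \<theta>\<^sup>2) =
        (\<Sum>b\<in>?B. expectation (\<lambda>\<omega>. Z a \<omega> * Z b \<omega>) - \<theta>\<^sup>2)"
      \<comment> \<open>Uncorrelated partners contribute zero, so only \<open>?B\<close>
        survives.\<close>
      by (rule sum.mono_neutral_right) (use fin in auto)
    also have "\<dots> \<le> (\<Sum>b\<in>?B. C)"
      by (rule sum_mono) (use a in \<open>auto intro!: le'\<close>)
    also have "\<dots> \<le> real K * C"
      using corr[OF a] C[OF a] by (simp add: mult_right_mono)
    finally show "(\<Sum>b\<in>A. expectation (\<lambda>\<omega>. Z a \<omega> * Z b \<omega>) - \<theta>\<^sup>2) \<le> real K * C" .
  qed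
  finally show "expectation (\<lambda>\<omega>. ((\<Sum>a\<in>A. Z a \<omega>) - real (card A) * \<theta>)\<^sup>2) \<le> real (card A) * real K * C"
    by simp
qed

section \<open>Blocks and pairs of coordinates of a power measure, and squares of products\<close>

lemma indep_var_PiM_restrict:
  assumes "prob_space M" and AB: "A \<inter> B = {}" "A \<subseteq> I" "B \<subseteq> I"
    and f: "f \<in> (\<Pi>\<^sub>M i\<in>A. M) \<rightarrow>\<^sub>M S" and g: "g \<in> (\<Pi>\<^sub>M i\<in>B. M) \<rightarrow>\<^sub>M T"
  shows "prob_space.indep_var (\<Pi>\<^sub>M i\<in>I. M) S (\<lambda>x. f (restrict x A)) T (\<lambda>x. g (restrict x B))"
proof -
  interpret prob_space "\<Pi>\<^sub>M i\<in>I. M" by (rule prob_space_PiM) (rule assms)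
  show ?thesis
    using indep_var_compose[OF indep_var_restrict[OF indep_vars_PiM_coordinates[OF assms(1)] AB] f g]
    by (simp add: comp_def)
qed

lemma indep_var_PiM_coordinates:
  assumes "prob_space M" "i \<in> I" "j \<in> I" "i \<noteq> j"
  shows "prob_space.indep_var (\<Pi>\<^sub>M i\<in>I. M) M (\<lambda>x. x i) M (\<lambda>x. x j)"
  using indep_var_PiM_restrict[OF assms(1), where A="{i}" and B="{j}" and f="\<lambda>x. x i" and g="\<lambda>x. x j"] assms(2-)
  by simp

lemma indep_var_PiM_coordinate_pairs:
  assumes "prob_space M" "{i, j, k, l} \<subseteq> I" "{i, j} \<inter> {k, l} = {}"
  shows "prob_space.indep_var (\<Pi>\<^sub>M i\<in>I. M) (M \<Otimes>\<^sub>M M) (\<lambda>x. (x i, x j)) (M \<Otimes>\<^sub>M M) (\<lambda>x. (x k, x l))"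
  using indep_var_PiM_restrict[OF assms(1), where A="{i, j}" and B="{k, l}"
      and f="\<lambda>x. (x i, x j)" and g="\<lambda>x. (x k, x l)" and S="M \<Otimes>\<^sub>M M" and T="M \<Otimes>\<^sub>M M"] assms(2-)
  by simp

lemma distr_PiM_coordinate_pair:
  assumes M: "prob_space M" "i \<in> I" "j \<in> I" "i \<noteq> j"
  shows "distr (\<Pi>\<^sub>M i\<in>I. M) (M \<Otimes>\<^sub>M M) (\<lambda>x. (x i, x j)) = M \<Otimes>\<^sub>M M"
proof -
  interpret prob_space "\<Pi>\<^sub>M i\<in>I. M" by (rule prob_space_PiM) (rule M)
  show ?thesis
    using indep_var_PiM_coordinates[OF M] M
    by (simp add: indep_var_distribution_eq distr_PiM_component[where M="\<lambda>_. M"])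
qed

text \<open>The arithmetic-geometric mean inequality, applied to the squares of \<open>X\<close> and
  \<open>Y\<close>, bounds the squared product by the average of the fourth powers. This is how the
  fourth moment of \<open>h\<close> controls the summands.\<close>

lemma product_square_bound:
  fixes X Y :: "'a \<Rightarrow> real"
  assumes [measurable]: "X \<in> borel_measurable M" "Y \<in> borel_measurable M"
    and X: "integrable M (\<lambda>\<omega>. X \<omega> ^ 4)" and Y: "integrable M (\<lambda>\<omega>. Y \<omega> ^ 4)"
    and "(\<integral>\<omega>. X \<omega> ^ 4 \<partial>M) \<le> C" "(\<integral>\<omega>. Y \<omega> ^ 4 \<partial>M) \<le> C"
  shows "integrable M (\<lambda>\<omega>. (X \<omega> * Y \<omega>)\<^sup>2)" and "(\<integral>\<omega>. (X \<omega> * Y \<omega>)\<^sup>2 \<partial>M) \<le> C"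
proof -
  have le: "(X \<omega> * Y \<omega>)\<^sup>2 \<le> (X \<omega> ^ 4 + Y \<omega> ^ 4) / 2" for \<omega>
    using sum_squares_bound[of "(X \<omega>)\<^sup>2" "(Y \<omega>)\<^sup>2"] by (simp add: power_mult_distrib)
  show int: "integrable M (\<lambda>\<omega>. (X \<omega> * Y \<omega>)\<^sup>2)"
  proof (rule Bochner_Integration.integrable_bound)
    show "integrable M (\<lambda>\<omega>. (X \<omega> ^ 4 + Y \<omega> ^ 4) / 2)" using X Y by simp
    show "AE \<omega> in M. norm ((X \<omega> * Y \<omega>)\<^sup>2) \<le> norm ((X \<omega> ^ 4 + Y \<omega> ^ 4) / 2)"
      using le by (intro AE_I2) (auto intro: order_trans[OF _ abs_ge_self])
  qed measurable
  have "(\<integral>\<omega>. (X \<omega> * Y \<omega>)\<^sup>2 \<partial>M) \<le> (\<integral>\<omega>. (X \<omega> ^ 4 + Y \<omega> ^ 4) / 2 \<partial>M)"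
    by (rule integral_mono[OF int _ le]) (use X Y in simp)
  then show "(\<integral>\<omega>. (X \<omega> * Y \<omega>)\<^sup>2 \<partial>M) \<le> C" using assms by simp
qed

section \<open>Counting index triples\<close>

text \<open>Flattens the nested triple sum of \<open>S_stat\<close> into one sum over a finite set,
  as the second-moment bound requires. The first entry indexes the X-sample, the other two the
  Y-sample.\<close>

definition sample_triples :: "nat \<Rightarrow> nat \<Rightarrow> (nat \<times> nat \<times> nat) set" where
  "sample_triples m1 m2 = {1..m1} \<times> (SIGMA j:{1..m2}. {1..m2} - {j})"

lemma finite_sample_triples [simp]: "finite (sample_triples m1 m2)"
  by (simp add: sample_triples_def)

lemma card_sample_triples: "card (sample_triples m1 m2) = m1 * (m2 * (m2 - 1))"
  by (simp add: sample_triples_def card_cartesian_product)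

text \<open>Sharing the X-index leaves the ordered Y-pair free. Sharing a Y-index means that
  \<open>j\<close> or \<open>k\<close> occurs in the first or second place, which gives four cases
  with the X-index and the other Y-index free.\<close>

lemma card_dependent_triples_le:
  assumes a: "(i, j, k) \<in> sample_triples m1 m2"
  shows "card {(i', j', k') \<in> sample_triples m1 m2. i' = i \<or> {j', k'} \<inter> {j, k} \<noteq> {}}
    \<le> m2 * (m2 - 1) + 4 * (m1 * (m2 - 1))"
proof -
  let ?T = "SIGMA j:{1..m2}. {1..m2} - {j}"
  \<comment> \<open>Ordered pairs of distinct indices with \<open>l\<close> in first place
    (\<open>?R\<close>) or in second place (\<open>?L\<close>).\<close>
  let ?R = "\<lambda>l. {l} \<times> ({1..m2} - {l})" and ?L = "\<lambda>l. ({1..m2} - {l}) \<times> {l}"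
  have "{(i', j', k') \<in> sample_triples m1 m2. i' = i \<or> {j', k'} \<inter> {j, k} \<noteq> {}}
      \<subseteq> {i} \<times> ?T \<union> {1..m1} \<times> (?R j \<union> ?R k \<union> (?L j \<union> ?L k))"
    by (auto simp: sample_triples_def)
  then have "card {(i', j', k') \<in> sample_triples m1 m2. i' = i \<or> {j', k'} \<inter> {j, k} \<noteq> {}}
      \<le> card ({i} \<times> ?T \<union> {1..m1} \<times> (?R j \<union> ?R k \<union> (?L j \<union> ?L k)))"
    by (rule card_mono[rotated]) auto
  also have "\<dots> \<le> card ({i} \<times> ?T) + card ({1..m1} \<times> (?R j \<union> ?R k \<union> (?L j \<union> ?L k)))"
    by (rule card_Un_le)
  also have "\<dots> = m2 * (m2 - 1) + m1 * card (?R j \<union> ?R k \<union> (?L j \<union> ?L k))"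
    by (simp add: card_cartesian_product)
  also have "\<dots> \<le> m2 * (m2 - 1) + m1 * (4 * (m2 - 1))"
  proof (intro add_mono mult_le_mono order_refl)
    have "card (?R j \<union> ?R k \<union> (?L j \<union> ?L k)) \<le> (card (?R j) + card (?R k)) + (card (?L j) + card (?L k))"
      by (intro order_trans[OF card_Un_le] add_mono card_Un_le)
    also have "\<dots> = 4 * (m2 - 1)"
      using a by (simp add: sample_triples_def card_cartesian_product)
    finally show "card (?R j \<union> ?R k \<union> (?L j \<union> ?L k)) \<le> 4 * (m2 - 1)" .
  qed
  finally show ?thesis by simp
qed

section \<open>Moments and correlations of the summands\<close>

locale two_sample = P: prob_space P + Q: prob_space Q
  for P :: "'a measure" and Q :: "'b measure" +
  fixes h :: "'a \<times> 'b \<Rightarrow> real"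
  assumes h[measurable]: "h \<in> borel_measurable (P \<Otimes>\<^sub>M Q)"
    and h4: "integrable (P \<Otimes>\<^sub>M Q) (\<lambda>z. h z ^ 4)"
begin

definition kernel :: "nat \<times> nat \<times> nat \<Rightarrow> (nat \<Rightarrow> 'a) \<times> (nat \<Rightarrow> 'b) \<Rightarrow> real" where
  "kernel = (\<lambda>(i, j, k) (x, y). h (x i, y j) * h (x i, y k))"

lemma prob_space_sample_measure: "prob_space (sample_measure P Q m1 m2)"
  unfolding sample_measure_def
  by (intro prob_space_pair prob_space_PiM P.prob_space_axioms Q.prob_space_axioms)

lemma distr_sample_pair:
  assumes "i \<in> {1..m1}" "j \<in> {1..m2}"
  shows "distr (sample_measure P Q m1 m2) (P \<Otimes>\<^sub>M Q) (\<lambda>(x, y). (x i, y j)) = P \<Otimes>\<^sub>M Q"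
proof -
  note [simp] = distr_PiM_component[where M="\<lambda>_. P"] distr_PiM_component[where M="\<lambda>_. Q"]
    P.prob_space_axioms Q.prob_space_axioms
  show ?thesis
    unfolding sample_measure_def using assms
    by (subst pair_measure_distr[symmetric]) (auto intro: prob_space_imp_sigma_finite)
qed

text \<open>Since \<open>j\<close> and \<open>k\<close> differ, the two Y-coordinates have law
  \<open>Q \<Otimes>\<^sub>M Q\<close>. Integrals of a summand thus move to a space that does not
  depend on the sample sizes or indices.\<close>

lemma distr_sample_triple:
  assumes "(i, j, k) \<in> sample_triples m1 m2"
  shows "distr (sample_measure P Q m1 m2) (P \<Otimes>\<^sub>M (Q \<Otimes>\<^sub>M Q)) (\<lambda>(x, y). (x i, (y j, y k))) = P \<Otimes>\<^sub>M (Q \<Otimes>\<^sub>M Q)"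
proof -
  have *: "i \<in> {1..m1}" "j \<in> {1..m2}" "k \<in> {1..m2}" "j \<noteq> k"
    using assms by (auto simp: sample_triples_def)
  have QQ: "prob_space (Q \<Otimes>\<^sub>M Q)"
    by (intro prob_space_pair Q.prob_space_axioms)
  note [simp] = distr_PiM_component[where M="\<lambda>_. P"] P.prob_space_axioms Q.prob_space_axioms
    distr_PiM_coordinate_pair[OF Q.prob_space_axioms *(2-4), simplified]
  show ?thesis
    unfolding sample_measure_def using * prob_space_imp_sigma_finite[OF QQ]
    by (subst pair_measure_distr[symmetric]) auto
qed

lemma h_sample_measurable [measurable]:
  assumes "i \<in> {1..m1}" "j \<in> {1..m2}"
  shows "(\<lambda>w. h (fst w i, snd w j)) \<in> borel_measurable (sample_measure P Q m1 m2)"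
  using assms unfolding sample_measure_def by measurable

lemma kernel_measurable:
  assumes "a \<in> sample_triples m1 m2"
  shows "kernel a \<in> borel_measurable (sample_measure P Q m1 m2)"
  using assms unfolding kernel_def sample_triples_def split_beta by (auto intro!: borel_measurable_times h_sample_measurable)

lemma h4_sample:
  assumes "i \<in> {1..m1}" "j \<in> {1..m2}"
  shows "integrable (sample_measure P Q m1 m2) (\<lambda>w. h (fst w i, snd w j) ^ 4)"
    and "(\<integral>w. h (fst w i, snd w j) ^ 4 \<partial>sample_measure P Q m1 m2) = (\<integral>z. h z ^ 4 \<partial>(P \<Otimes>\<^sub>M Q))"
proof -
  have [measurable]: "(\<lambda>(x, y). (x i, y j)) \<in> sample_measure P Q m1 m2 \<rightarrow>\<^sub>M P \<Otimes>\<^sub>M Q"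
    using assms unfolding sample_measure_def by measurable
  show "integrable (sample_measure P Q m1 m2) (\<lambda>w. h (fst w i, snd w j) ^ 4)"
    using h4 by (subst (asm) distr_sample_pair[OF assms, symmetric], subst (asm) integrable_distr_eq)
      (auto simp: split_beta)
  show "(\<integral>w. h (fst w i, snd w j) ^ 4 \<partial>sample_measure P Q m1 m2) = (\<integral>z. h z ^ 4 \<partial>(P \<Otimes>\<^sub>M Q))"
    by (subst distr_sample_pair[OF assms, symmetric], subst integral_distr) (auto simp: split_beta)
qed

lemma kernel_square:
  assumes "a \<in> sample_triples m1 m2"
  shows "integrable (sample_measure P Q m1 m2) (\<lambda>w. (kernel a w)\<^sup>2)"
    and "(\<integral>w. (kernel a w)\<^sup>2 \<partial>sample_measure P Q m1 m2) \<le> (\<integral>z. h z ^ 4 \<partial>(P \<Otimes>\<^sub>M Q))"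
proof -
  obtain i j k where a: "a = (i, j, k)" and ijk: "i \<in> {1..m1}" "j \<in> {1..m2}" "k \<in> {1..m2}"
    using assms by (auto simp: sample_triples_def)
  \<comment> \<open>The two factors are \<open>h\<close> at the index pairs \<open>(i, j)\<close>
    and \<open>(i, k)\<close>; both have exactly the fourth moment of \<open>h\<close>, so
    \<open>eq_refl\<close> supplies the required upper bounds.\<close>
  note bound = product_square_bound[OF h_sample_measurable h_sample_measurable h4_sample(1) h4_sample(1)
      eq_refl[OF h4_sample(2)] eq_refl[OF h4_sample(2)],
      OF ijk(1,2) ijk(1,3) ijk(1,2) ijk(1,3) ijk(1,2) ijk(1,3)]
  show "integrable (sample_measure P Q m1 m2) (\<lambda>w. (kernel a w)\<^sup>2)"
    "(\<integral>w. (kernel a w)\<^sup>2 \<partial>sample_measure P Q m1 m2) \<le> (\<integral>z. h z ^ 4 \<partial>(P \<Otimes>\<^sub>M Q))"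
    using bound by (simp_all add: kernel_def a split_beta)
qed

lemma kernel_integrable:
  assumes "a \<in> sample_triples m1 m2"
  shows "integrable (sample_measure P Q m1 m2) (kernel a)"
proof -
  interpret prob_space "sample_measure P Q m1 m2" by (rule prob_space_sample_measure)
  show ?thesis
    by (rule square_integrable_imp_integrable[OF kernel_measurable kernel_square(1)]) fact+
qed

text \<open>After transfer to the law of one triple, Fubini fixes \<open>x\<close>; the two
  Y-variables are then independent, so the inner integral is a product of two equal factors.\<close>

lemma kernel_expectation:
  assumes "a \<in> sample_triples m1 m2"
  shows "(\<integral>w. kernel a w \<partial>sample_measure P Q m1 m2) = (\<integral>x. (\<integral>y. h (x, y) \<partial>Q)\<^sup>2 \<partial>P)"
proof -
  obtain i j k where a: "a = (i, j, k)" by (cases a)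
  have ijk: "(i, j, k) \<in> sample_triples m1 m2" "i \<in> {1..m1}" "j \<in> {1..m2}" "k \<in> {1..m2}"
    using assms a by (auto simp: sample_triples_def)
  let ?f = "\<lambda>(x, u, v). h (x, u) * h (x, v)"
  have [measurable]: "(\<lambda>(x, y). (x i, (y j, y k))) \<in> sample_measure P Q m1 m2 \<rightarrow>\<^sub>M P \<Otimes>\<^sub>M (Q \<Otimes>\<^sub>M Q)"
    using ijk(2-) unfolding sample_measure_def by measurable
  have k: "kernel a = (\<lambda>w. ?f ((\<lambda>(x, y). (x i, (y j, y k))) w))"
    by (auto simp: kernel_def a)
  have int: "integrable (P \<Otimes>\<^sub>M (Q \<Otimes>\<^sub>M Q)) ?f"
    using kernel_integrable[OF assms] unfolding k
    by (subst distr_sample_triple[OF ijk(1), symmetric], subst integrable_distr_eq) simp_all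
  interpret QQ: pair_prob_space Q Q ..
  interpret PQQ: pair_prob_space P "Q \<Otimes>\<^sub>M Q" ..
  have "(\<integral>w. kernel a w \<partial>sample_measure P Q m1 m2) = (\<integral>z. ?f z \<partial>(P \<Otimes>\<^sub>M (Q \<Otimes>\<^sub>M Q)))"
    unfolding k by (subst distr_sample_triple[OF ijk(1), symmetric], subst integral_distr) simp_all
  also have "\<dots> = (\<integral>x. (\<integral>z. ?f (x, z) \<partial>(Q \<Otimes>\<^sub>M Q)) \<partial>P)"
    by (rule PQQ.integral_fst'[OF int, symmetric])
  also have "\<dots> = (\<integral>x. (\<integral>y. h (x, y) \<partial>Q)\<^sup>2 \<partial>P)"
  \<comment> \<open>The section at \<open>x\<close> is known to be integrable only for almost every
    \<open>x\<close>, so the inner factorisation holds almost everywhere.\<close>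
  proof (rule integral_cong_AE)
    show "AE x in P. (\<integral>z. ?f (x, z) \<partial>(Q \<Otimes>\<^sub>M Q)) = (\<integral>y. h (x, y) \<partial>Q)\<^sup>2"
      using PQQ.AE_integrable_fst'[OF int]
    proof eventually_elim
      fix x assume "integrable (Q \<Otimes>\<^sub>M Q) (\<lambda>z. ?f (x, z))"
      from QQ.integral_fst'[OF this]
      show "(\<integral>z. ?f (x, z) \<partial>(Q \<Otimes>\<^sub>M Q)) = (\<integral>y. h (x, y) \<partial>Q)\<^sup>2"
        by (simp add: power2_eq_square)
    qed
  qed measurable
  finally show ?thesis .
qed

text \<open>Distinct X-indices give independence in the first factor of the sample space and
  disjoint Y-pairs in the second; \<open>indep_var_pair_measure\<close> joins the two, and the mean
  of the product splits.\<close>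

lemma kernel_uncorrelated:
  assumes ijk: "(i, j, k) \<in> sample_triples m1 m2" and ijk': "(i', j', k') \<in> sample_triples m1 m2"
    and disj: "i' \<noteq> i" "{j', k'} \<inter> {j, k} = {}"
  shows "(\<integral>w. kernel (i, j, k) w * kernel (i', j', k') w \<partial>sample_measure P Q m1 m2)
    = (\<integral>x. (\<integral>y. h (x, y) \<partial>Q)\<^sup>2 \<partial>P)\<^sup>2"
proof -
  let ?N = "sample_measure P Q m1 m2"
  interpret N: prob_space ?N by (rule prob_space_sample_measure)
  interpret A: prob_space "\<Pi>\<^sub>M i\<in>{1..m1}. P" by (rule prob_space_PiM) (rule P.prob_space_axioms)
  interpret B: prob_space "\<Pi>\<^sub>M i\<in>{1..m2}. Q" by (rule prob_space_PiM) (rule Q.prob_space_axioms)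
  interpret AB: pair_prob_space "\<Pi>\<^sub>M i\<in>{1..m1}. P" "\<Pi>\<^sub>M i\<in>{1..m2}. Q" ..
  let ?f = "\<lambda>(x, u, v). h (x, u) * h (x, v)"
  have k: "kernel (i, j, k) = ?f \<circ> (\<lambda>(x, y). (x i, (y j, y k)))" for i j k
    by (auto simp: kernel_def)
  have "A.indep_var P (\<lambda>x. x i) P (\<lambda>x. x i')"
    using ijk ijk' disj(1)
    by (intro indep_var_PiM_coordinates P.prob_space_axioms) (auto simp: sample_triples_def)
  moreover have "B.indep_var (Q \<Otimes>\<^sub>M Q) (\<lambda>y. (y j, y k)) (Q \<Otimes>\<^sub>M Q) (\<lambda>y. (y j', y k'))"
    using ijk ijk' disj(2)
    by (intro indep_var_PiM_coordinate_pairs Q.prob_space_axioms) (auto simp: sample_triples_def)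
  ultimately have "N.indep_var (P \<Otimes>\<^sub>M (Q \<Otimes>\<^sub>M Q)) (\<lambda>(x, y). (x i, (y j, y k)))
      (P \<Otimes>\<^sub>M (Q \<Otimes>\<^sub>M Q)) (\<lambda>(x, y). (x i', (y j', y k')))"
    unfolding sample_measure_def by (rule AB.indep_var_pair_measure)
  then have "N.indep_var borel (kernel (i, j, k)) borel (kernel (i', j', k'))"
    unfolding k by (rule N.indep_var_compose) measurable
  from N.indep_var_lebesgue_integral[OF this kernel_integrable[OF ijk] kernel_integrable[OF ijk']]
  show ?thesis
    by (simp add: kernel_expectation[OF ijk] kernel_expectation[OF ijk'] power2_eq_square)
qed

section \<open>Unbiasedness and consistency of the statistic\<close>

lemma S_stat_eq:
  "S_stat h m1 m2 w = 1 / real (card (sample_triples m1 m2)) * (\<Sum>a\<in>sample_triples m1 m2. kernel a w)"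
proof -
  obtain x y where w: "w = (x, y)" by (cases w)
  have "(\<Sum>a\<in>sample_triples m1 m2. kernel a w)
      = (\<Sum>i\<in>{1..m1}. \<Sum>p\<in>(SIGMA j:{1..m2}. {1..m2} - {j}). case p of (j, k) \<Rightarrow> kernel (i, j, k) w)"
    unfolding sample_triples_def by (simp add: sum.cartesian_product' split_beta)
  also have "\<dots> = (\<Sum>i\<in>{1..m1}. \<Sum>j\<in>{1..m2}. \<Sum>k\<in>{1..m2} - {j}. kernel (i, j, k) w)"
    by (subst sum.Sigma) simp_all
  finally have sum: "(\<Sum>a\<in>sample_triples m1 m2. kernel a w) = \<dots>" .
  show ?thesis
  \<comment> \<open>The cardinality involves the truncated \<open>m2 - 1\<close>, whereas
    \<open>S_stat\<close> subtracts in the reals; they disagree at \<open>m2 = 0\<close>, where both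
    sides are zero anyway.\<close>
  proof (cases m2)
    case (Suc m)
    then have card: "real (card (sample_triples m1 m2)) = real m1 * real m2 * (real m2 - 1)"
      by (simp add: card_sample_triples algebra_simps)
    show ?thesis
      \<comment> \<open>\<open>kernel\<close> multiplies the two values of \<open>h\<close> in the
        opposite order to \<open>S_stat\<close>.\<close>
      unfolding sum card unfolding S_stat_def kernel_def w by (simp add: mult.commute)
  qed (simp add: S_stat_def w sample_triples_def)
qed

lemma S_stat_measurable: "S_stat h m1 m2 \<in> borel_measurable (sample_measure P Q m1 m2)"
  unfolding S_stat_eq[abs_def]
  by (intro borel_measurable_times borel_measurable_const borel_measurable_sum kernel_measurable)

text \<open>Linearity over the triples: all summands have the same mean, and the size conditions
  make the number of triples nonzero, so the normalisation cancels.\<close>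

lemma unbiased_S_stat:
  assumes "m1 \<ge> 1" "m2 \<ge> 2"
  shows "unbiased_estimator (sample_measure P Q m1 m2) (S_stat h m1 m2)
    (\<integral>x. (\<integral>y. h (x, y) \<partial>Q)\<^sup>2 \<partial>P)"
  unfolding unbiased_estimator_def S_stat_eq[abs_def] using assms
  by (auto simp: kernel_integrable kernel_expectation card_sample_triples)

text \<open>Chebyshev's inequality for the centred sum \<open>D\<close>, whose second moment is at
  most \<open>T * K * C\<close>; the ratio of \<open>K\<close> to \<open>T\<close> produces the
  rate.\<close>

lemma S_stat_concentration:
  assumes m: "m1 \<ge> 1" "m2 \<ge> 2" and "\<epsilon> > 0"
  shows "measure (sample_measure P Q m1 m2) {w \<in> space (sample_measure P Q m1 m2).
      \<bar>S_stat h m1 m2 w - (\<integral>x. (\<integral>y. h (x, y) \<partial>Q)\<^sup>2 \<partial>P)\<bar> > \<epsilon>}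
    \<le> (1 / real m1 + 4 / real m2) * (\<integral>z. h z ^ 4 \<partial>(P \<Otimes>\<^sub>M Q)) / \<epsilon>\<^sup>2"
proof -
  let ?N = "sample_measure P Q m1 m2"
  define \<theta> where "\<theta> = (\<integral>x. (\<integral>y. h (x, y) \<partial>Q)\<^sup>2 \<partial>P)"
  define C where "C = (\<integral>z. h z ^ 4 \<partial>(P \<Otimes>\<^sub>M Q))"
  define T where "T = card (sample_triples m1 m2)"
  define K where "K = m2 * (m2 - 1) + 4 * (m1 * (m2 - 1))"
  define D where "D w = (\<Sum>a\<in>sample_triples m1 m2. kernel a w) - real T * \<theta>" for w
  interpret N: prob_space ?N by (rule prob_space_sample_measure)
  have T: "real T > 0" using m by (simp add: T_def card_sample_triples)
  have corr: "card {b \<in> sample_triples m1 m2. N.expectation (\<lambda>w. kernel a w * kernel b w) \<noteq> \<theta>\<^sup>2} \<le> K"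
    if a: "a \<in> sample_triples m1 m2" for a
  proof -
    obtain i j k where ijk: "a = (i, j, k)" by (cases a)
    \<comment> \<open>Contrapositive of \<open>kernel_uncorrelated\<close>: correlated triples must
      share an index.\<close>
    have "{b \<in> sample_triples m1 m2. N.expectation (\<lambda>w. kernel a w * kernel b w) \<noteq> \<theta>\<^sup>2}
        \<subseteq> {(i', j', k') \<in> sample_triples m1 m2. i' = i \<or> {j', k'} \<inter> {j, k} \<noteq> {}}"
      using kernel_uncorrelated[OF a[unfolded ijk]] unfolding ijk \<theta>_def by blast
    then have "card {b \<in> sample_triples m1 m2. N.expectation (\<lambda>w. kernel a w * kernel b w) \<noteq> \<theta>\<^sup>2}
        \<le> card {(i', j', k') \<in> sample_triples m1 m2. i' = i \<or> {j', k'} \<inter> {j, k} \<noteq> {}}"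
      by (rule card_mono[rotated]) (rule finite_subset[OF _ finite_sample_triples[of m1 m2]], auto)
    also have "\<dots> \<le> K"
      unfolding K_def by (rule card_dependent_triples_le) (use a ijk in simp)
    finally show ?thesis .
  qed
  note moment = N.second_moment_sum_le[where A="sample_triples m1 m2" and Z=kernel and \<theta>=\<theta> and C=C and K=K,
      OF finite_sample_triples kernel_measurable kernel_square(1) kernel_expectation[folded \<theta>_def]
      kernel_square(2)[folded C_def] corr, folded T_def, folded D_def]
  have D[measurable]: "D \<in> borel_measurable ?N"
    unfolding D_def[abs_def] by (intro borel_measurable_diff borel_measurable_const borel_measurable_sum kernel_measurable)
  have eq: "\<bar>S_stat h m1 m2 w - \<theta>\<bar> = \<bar>D w\<bar> / real T" for w
  proof -
    have "S_stat h m1 m2 w - \<theta> = D w / real T"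
      using T by (simp add: S_stat_eq T_def[symmetric] D_def field_simps)
    then show ?thesis by simp
  qed
  have "measure ?N {w \<in> space ?N. \<bar>S_stat h m1 m2 w - \<theta>\<bar> > \<epsilon>}
      \<le> measure ?N {w \<in> space ?N. \<bar>D w\<bar> \<ge> real T * \<epsilon>}"
    unfolding eq using T by (intro N.finite_measure_mono) (auto simp: field_simps)
  also have "\<dots> \<le> N.expectation (\<lambda>w. (D w)\<^sup>2) / (real T * \<epsilon>)\<^sup>2"
    by (rule N.second_moment_method[OF D]) (use moment(1) T \<open>\<epsilon> > 0\<close> in simp_all)
  also have "\<dots> \<le> real T * real K * C / (real T * \<epsilon>)\<^sup>2"
    by (rule divide_right_mono) (use moment(2) in simp_all)
  also have "\<dots> = (real K / real T) * C / \<epsilon>\<^sup>2"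
    using T \<open>\<epsilon> > 0\<close> by (simp add: field_simps power2_eq_square)
  also have "real K / real T = 1 / real m1 + 4 / real m2"
  proof -
    \<comment> \<open>\<open>real (m2 - 1)\<close> is kept as a single positive term, a common
      factor of \<open>K\<close> and \<open>T\<close> that cancels.\<close>
    have "real (m2 - 1) > 0" using m by simp
    then show ?thesis
      using m by (simp add: K_def T_def card_sample_triples divide_simps del: of_nat_diff) (simp add: algebra_simps del: of_nat_diff)
  qed
  finally show ?thesis unfolding \<theta>_def C_def .
qed

lemma consistent_S_stat:
  assumes "filterlim n1 at_top sequentially" "filterlim n2 at_top sequentially"
  shows "consistent_estimator (\<lambda>n. sample_measure P Q (n1 n) (n2 n)) (\<lambda>n. S_stat h (n1 n) (n2 n))
    (\<integral>x. (\<integral>y. h (x, y) \<partial>Q)\<^sup>2 \<partial>P)"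
  unfolding consistent_estimator_def
proof (intro conjI allI impI)
  fix \<epsilon> :: real assume "\<epsilon> > 0"
  have real: "filterlim (\<lambda>n. real (m n)) at_top sequentially" if "filterlim m at_top sequentially" for m :: "nat \<Rightarrow> nat"
    by (rule filterlim_compose[OF filterlim_real_sequentially that])
  let ?B = "\<lambda>n. (1 / real (n1 n) + 4 / real (n2 n)) * (\<integral>z. h z ^ 4 \<partial>(P \<Otimes>\<^sub>M Q)) / \<epsilon>\<^sup>2"
  have "?B \<longlonglongrightarrow> (0 + 0) * (\<integral>z. h z ^ 4 \<partial>(P \<Otimes>\<^sub>M Q)) / \<epsilon>\<^sup>2"
    using \<open>\<epsilon> > 0\<close> by (intro tendsto_intros tendsto_divide_0[OF tendsto_const]
      filterlim_at_top_imp_at_infinity real assms) simp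
  then have B: "?B \<longlonglongrightarrow> 0" by simp
  \<comment> \<open>The concentration bound applies only from these sizes on, which suffices for the
    limit.\<close>
  have "eventually (\<lambda>n. n1 n \<ge> 1 \<and> n2 n \<ge> 2) sequentially"
    using assms by (auto simp: filterlim_at_top eventually_conj_iff)
  then have "eventually (\<lambda>n. measure (sample_measure P Q (n1 n) (n2 n)) {w \<in> space (sample_measure P Q (n1 n) (n2 n)).
      \<bar>S_stat h (n1 n) (n2 n) w - (\<integral>x. (\<integral>y. h (x, y) \<partial>Q)\<^sup>2 \<partial>P)\<bar> > \<epsilon>} \<le> ?B n) sequentially"
    by eventually_elim (rule S_stat_concentration; use \<open>\<epsilon> > 0\<close> in simp)
  then show "(\<lambda>n. measure (sample_measure P Q (n1 n) (n2 n)) {w \<in> space (sample_measure P Q (n1 n) (n2 n)).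
      \<bar>S_stat h (n1 n) (n2 n) w - (\<integral>x. (\<integral>y. h (x, y) \<partial>Q)\<^sup>2 \<partial>P)\<bar> > \<epsilon>}) \<longlonglongrightarrow> 0"
    by (intro tendsto_sandwich[OF _ _ tendsto_const B]) simp_all
qed (rule S_stat_measurable)

end

section \<open>Growth of the sample sizes, and the theorem\<close>

lemma filterlim_at_top_of_positive_fraction:
  fixes m :: "nat \<Rightarrow> nat"
  assumes "(\<lambda>n. real (m n) / real n) \<longlonglongrightarrow> c" "c > 0"
  shows "filterlim m at_top sequentially"
proof -
  have "filterlim (\<lambda>n. real (m n) / real n * real n) at_top sequentially"
    by (rule filterlim_tendsto_pos_mult_at_top[OF assms filterlim_real_sequentially])
  \<comment> \<open>Cancellation can fail at \<open>n = 0\<close>, where division by zero yields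
    0.\<close>
  moreover have "eventually (\<lambda>n. real (m n) / real n * real n = real (m n)) sequentially"
    using eventually_gt_at_top[of 0] by eventually_elim simp
  ultimately have "filterlim (\<lambda>n. real (m n)) at_top sequentially"
    by (simp cong: filterlim_cong)
  then show ?thesis
    by (simp add: filterlim_sequentially_iff_filterlim_real)
qed

theorem lemma5p11:
  fixes P :: "'a measure" and Q :: "'b measure"
    and h :: "'a \<times> 'b \<Rightarrow> real"
    and n1 n2 :: "nat \<Rightarrow> nat" and d :: real
  assumes "prob_space P" and "prob_space Q"
    and "h \<in> borel_measurable (P \<Otimes>\<^sub>M Q)"
    and "integrable (P \<Otimes>\<^sub>M Q) (\<lambda>z. h z ^ 4)"
    and "(\<integral>z. h z \<partial>(P \<Otimes>\<^sub>M Q)) = 0"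
    and "\<And>n. n1 n + n2 n = n"
    and "(\<lambda>n. real (n2 n) / real n) \<longlonglongrightarrow> d"
    and "0 < d" and "d < 1"
  shows "(\<forall>n. n1 n \<ge> 1 \<longrightarrow> n2 n \<ge> 2 \<longrightarrow>
            unbiased_estimator (sample_measure P Q (n1 n) (n2 n)) (S_stat h (n1 n) (n2 n))
              (\<integral>x. (\<integral>y. h (x, y) \<partial>Q)\<^sup>2 \<partial>P))
       \<and> consistent_estimator (\<lambda>n. sample_measure P Q (n1 n) (n2 n))
            (\<lambda>n. S_stat h (n1 n) (n2 n))
            (\<integral>x. (\<integral>y. h (x, y) \<partial>Q)\<^sup>2 \<partial>P)"
proof -
  interpret two_sample P Q h
    using assms(1-4) by (simp add: two_sample_def two_sample_axioms_def)
  \<comment> \<open>The X-fraction is the complement of the Y-fraction, so it tends to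
    \<open>1 - d\<close>, which is positive. At \<open>n = 0\<close> the two sides are 1 and 0,
    hence the restriction to positive \<open>n\<close>.\<close>
  have "eventually (\<lambda>n. 1 - real (n2 n) / real n = real (n1 n) / real n) sequentially"
    using eventually_gt_at_top[of 0]
  proof eventually_elim
    case (elim n)
    have "real n = real (n1 n) + real (n2 n)"
      using assms(6)[of n] by (metis of_nat_add)
    with elim show ?case by (simp add: field_simps)
  qed
  then have "(\<lambda>n. real (n1 n) / real n) \<longlonglongrightarrow> 1 - d"
    by (rule Lim_transform_eventually[rotated]) (intro tendsto_intros assms(7))
  then have "filterlim n1 at_top sequentially"
    by (rule filterlim_at_top_of_positive_fraction) (use \<open>d < 1\<close> in simp)
  moreover have "filterlim n2 at_top sequentially"
    by (rule filterlim_at_top_of_positive_fraction) fact+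
  ultimately show ?thesis
    using unbiased_S_stat consistent_S_stat by blast
qed

end
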